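(* There is no Lebesgue-integrable objective-space density kernel $K$ such that $\mathrm{WHV}_{K,r}(A)=I_{R_2}(A;r)$ for all finite sets $A$, already in two-objective minimization with $z^+=(0,0)$ and $r=(1,1)$.
   Context: Minimization convention with $m$ objectives (in the case named in the claim, $m=2$). For a finite approximation set $A\subset\mathbb{R}^m$ and reference point $r\in\mathbb{R}^m$, the dominated region is $\mathrm{Dom}_r(A)=\bigcup_{a\in A}[a_1,r_1]\times\cdots\times[a_m,r_m]$, and the weighted hypervolume with objective-space density kernel $K$ is $\mathrm{WHV}_{K,r}(A)=\int_{\mathrm{Dom}_r(A)}K(y)\,dy$. The weight simplex is $\Delta^{m-1}=\{\lambda\in\mathbb{R}_+^m:\sum_i\lambda_i=1\}$ with surface measure $\sigma$, and $\rho$ is a nonnegative weight density on $\Delta^{m-1}$. With utopian point $z^+$, the weighted Tchebycheff scalarization is $g_\lambda(y;z^+)=\max_i\lambda_i(y_i-z_i^+)$; the scalarization envelope of $A$ is $h_A(\lambda)=\min_{a\in A}g_\lambda(a;z^+)$, and $h_r(\lambda)=g_\lambda(r;z^+)$. The exact integral $R_2$ improvement is $I_{R_2}(A;r)=\int_{\Delta^{m-1}}(h_r(\lambda)-h_A(\lambda))_+\,\rho(\lambda)\,d\sigma(\lambda)$, where $(u)_+=\max\{u,0\}$.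
   Formalization: The weight density ρ is additionally assumed to be measurable and not almost everywhere zero on the simplex; for ρ = 0 the claim fails, since the kernel K = 0 then represents the improvement. *)

theory Defs
  imports "HOL-Analysis.Analysis"
begin

definition dominated_region :: "real ^ 'm \<Rightarrow> (real ^ 'm) set \<Rightarrow> (real ^ 'm) set" where
  "dominated_region r A = (\<Union>a\<in>A. cbox a r)"

definition weighted_hypervolume ::
    "(real ^ 'm \<Rightarrow> real) \<Rightarrow> real ^ 'm \<Rightarrow> (real ^ 'm) set \<Rightarrow> real" where
  "weighted_hypervolume K r A = set_lebesgue_integral lebesgue (dominated_region r A) K"

definition weight_simplex :: "(real ^ 'm) set" where
  "weight_simplex = {l. (\<forall>i. 0 \<le> l $ i) \<and> (\<Sum>i\<in>UNIV. l $ i) = 1}"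

definition tchebycheff :: "real ^ 'm \<Rightarrow> real ^ 'm \<Rightarrow> real ^ 'm \<Rightarrow> real" where
  "tchebycheff z l y = (MAX i\<in>UNIV. l $ i * (y $ i - z $ i))"

text \<open>Meaningful for finite nonempty \<open>A\<close> only.\<close>

definition envelope :: "real ^ 'm \<Rightarrow> (real ^ 'm) set \<Rightarrow> real ^ 'm \<Rightarrow> real" where
  "envelope z A l = (MIN a\<in>A. tchebycheff z l a)"

text \<open>The integrand is nonnegative when \<open>\<rho>\<close> is, so the integral is taken in \<open>[0, \<infinity>]\<close>;
  it is finite for every \<open>A\<close> if \<open>\<rho>\<close> is \<open>\<sigma>\<close>-integrable on the simplex. The surface measure
  \<open>\<sigma>\<close> on the simplex is a parameter; for two objectives it is \<open>surface2\<close> below.\<close>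

definition R2_improvement ::
    "(real ^ 'm) measure \<Rightarrow> (real ^ 'm \<Rightarrow> real) \<Rightarrow> real ^ 'm \<Rightarrow> real ^ 'm \<Rightarrow> (real ^ 'm) set \<Rightarrow> ennreal"
  where
  "R2_improvement \<sigma> \<rho> z r A =
     (\<integral>\<^sup>+l\<in>weight_simplex. ennreal (max (tchebycheff z l r - envelope z A l) 0 * \<rho> l) \<partial>\<sigma>)"

text \<open>For two objectives the simplex is the segment from \<open>(0, 1)\<close> to \<open>(1, 0)\<close>, and its surface
  measure is arc length: the (completed) image of Lebesgue measure under the unit-speed
  parametrization of the segment. The lemmas below confirm this.\<close>

definition simplex2_arc :: "real \<Rightarrow> real ^ 2" where
  "simplex2_arc s = vector [s / sqrt 2, 1 - s / sqrt 2]"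

definition surface2 :: "(real ^ 2) measure" where
  "surface2 = completion (distr (restrict_space lborel {0..sqrt 2}) borel simplex2_arc)"

lemma simplex2_arc_image: "simplex2_arc ` {0..sqrt 2} = weight_simplex"
proof
  show "simplex2_arc ` {0..sqrt 2} \<subseteq> weight_simplex"
    by (auto simp: simplex2_arc_def weight_simplex_def sum_2 forall_2 divide_le_eq_1)
next
  show "weight_simplex \<subseteq> simplex2_arc ` {0..sqrt 2}"
  proof
    fix l :: "real ^ 2" assume "l \<in> weight_simplex"
    then have l: "0 \<le> l $ 1" "0 \<le> l $ 2" "l $ 1 + l $ 2 = 1"
      by (auto simp: weight_simplex_def sum_2)
    have "l = simplex2_arc (sqrt 2 * l $ 1)"
      using l by (auto simp: vec_eq_iff forall_2 simplex2_arc_def)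
    moreover have "sqrt 2 * l $ 1 \<in> {0..sqrt 2}"
      using l by (auto intro: mult_left_le)
    ultimately show "l \<in> simplex2_arc ` {0..sqrt 2}"
      by blast
  qed
qed

lemma dist_simplex2_arc: "dist (simplex2_arc s) (simplex2_arc t) = dist s t"
proof -
  have "(s / sqrt 2 - t / sqrt 2)\<^sup>2 + (t / sqrt 2 - s / sqrt 2)\<^sup>2 = (s - t)\<^sup>2"
    by (simp add: diff_divide_distrib [symmetric] power_divide power2_commute [of t s])
  then show ?thesis
    by (simp add: dist_vec_def L2_set_def sum_2 simplex2_arc_def dist_real_def)
qed

lemma emeasure_surface2_simplex: "emeasure surface2 weight_simplex = ennreal (sqrt 2)"
proof -
  let ?M = "restrict_space lborel {0..sqrt 2}"
  have cont: "continuous_on UNIV simplex2_arc"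
    unfolding continuous_on_iff by (auto simp: dist_simplex2_arc)
  have meas: "simplex2_arc \<in> measurable ?M borel"
    using borel_measurable_continuous_onI [OF cont] by (simp add: measurable_restrict_space1)
  have "compact (weight_simplex :: (real ^ 2) set)"
    unfolding simplex2_arc_image [symmetric]
    by (rule compact_continuous_image [OF continuous_on_subset [OF cont]]) auto
  then have S: "weight_simplex \<in> sets (borel :: (real ^ 2) measure)"
    by (simp add: borel_closed compact_imp_closed)
  have "simplex2_arc -` weight_simplex \<inter> space ?M = {0..sqrt 2}"
    using simplex2_arc_image by (auto simp: space_restrict_space)
  then show ?thesis
    using S by (simp add: surface2_def emeasure_distr [OF meas] emeasure_restrict_space)
qed

end

theory Submission
  imports Defs
begin

text \<open>A density \<open>K\<close> cannot see a box of Lebesgue measure zero, but the \<open>R2\<close> improvement can.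
  The points \<open>(1, 0)\<close> and \<open>(0, 1)\<close> lie on the boundary of the orthant below \<open>r = (1, 1)\<close>, so
  each dominates only a segment and every weighted hypervolume of the pair vanishes. For a weight
  \<open>l\<close>, however, the scalarized value of \<open>r\<close> is \<open>max l\<^sub>1 l\<^sub>2\<close>, while the better of the
  two points attains \<open>min l\<^sub>1 l\<^sub>2\<close>. The improvement is therefore the integral of
  \<open>\<bar>l\<^sub>1 - l\<^sub>2\<bar> \<rho>(l)\<close>, and since the midpoint of the simplex is a null set for arc length,
  it can vanish only if \<open>\<rho>\<close> vanishes almost everywhere.

  So one two-point set, chosen independently of \<open>K\<close>, refutes every kernel
  (\<open>weighted_hypervolume_degenerate\<close> and \<open>R2_improvement_unit_vectors_eq_0_iff\<close>).\<close>

text \<open>A point that ties with \<open>r\<close> in some coordinate spans with \<open>r\<close> a box of width zero in that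
  coordinate, however far it lies below \<open>r\<close> in the others.\<close>

lemma negligible_dominated_region:
  assumes "finite A" and "\<And>a. a \<in> A \<Longrightarrow> \<exists>i. a $ i = r $ i"
  shows "negligible (dominated_region r A)"
proof -
  have "negligible (cbox a r)" if "a \<in> A" for a
  proof -
    obtain i where "a $ i = r $ i"
      using assms(2) \<open>a \<in> A\<close> by blast
    then have "box a r = {}"
      by (auto simp: interval_eq_empty_cart intro: order_eq_refl [OF sym])
    then show ?thesis
      by (simp add: negligible_interval)
  qed
  then show ?thesis
    unfolding dominated_region_def using assms(1) by (auto intro!: negligible_Union)
qed

lemma weighted_hypervolume_degenerate:
  assumes "finite A" and "\<And>a. a \<in> A \<Longrightarrow> \<exists>i. a $ i = r $ i"
  shows "weighted_hypervolume K r A = 0"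
proof -
  have "dominated_region r A \<in> null_sets lebesgue"
    using negligible_dominated_region [OF assms] by (simp add: negligible_iff_null_sets)
  then have "AE y in lebesgue. indicator (dominated_region r A) y *\<^sub>R K y = 0"
    by (rule AE_I') (auto simp: indicator_def)
  then show ?thesis
    unfolding weighted_hypervolume_def set_lebesgue_integral_def by (rule integral_eq_zero_AE)
qed

lemma tchebycheff_2:
  fixes l :: "real ^ 2"
  shows "tchebycheff z l y = max (l $ 1 * (y $ 1 - z $ 1)) (l $ 2 * (y $ 2 - z $ 2))"
  unfolding tchebycheff_def UNIV_2 by simp

lemma improvement_integrand_unit_vectors:
  fixes l :: "real ^ 2"
  assumes "l \<in> weight_simplex"
  shows "max (tchebycheff (vector [0, 0]) l (vector [1, 1]) -
           envelope (vector [0, 0]) {vector [1, 0], vector [0, 1]} l) 0 = \<bar>l $ 1 - l $ 2\<bar>"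
proof -
  have "0 \<le> l $ 1" "0 \<le> l $ 2"
    using assms by (auto simp: weight_simplex_def)
  then show ?thesis
    unfolding envelope_def tchebycheff_2 by simp
qed

lemma continuous_on_simplex2_arc: "continuous_on UNIV simplex2_arc"
  unfolding continuous_on_iff by (auto simp: dist_simplex2_arc)

lemma AE_surface2_components_distinct: "AE l in surface2. l $ 1 \<noteq> l $ 2"
proof -
  let ?M = "restrict_space lborel {0..sqrt 2}"
  have meas: "simplex2_arc \<in> measurable ?M borel"
    using borel_measurable_continuous_onI [OF continuous_on_simplex2_arc]
    by (simp add: measurable_restrict_space1)
  \<comment> \<open>The arc reaches the midpoint \<open>(1/2, 1/2)\<close> of the simplex at parameter \<open>sqrt 2 / 2\<close> only.\<close>
  have "AE s in lborel. s \<noteq> sqrt 2 / 2"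
    by (rule AE_lborel_singleton)
  then have "AE s in lborel. s \<in> {0..sqrt 2} \<longrightarrow> simplex2_arc s $ 1 \<noteq> simplex2_arc s $ 2"
    by eventually_elim (auto simp: simplex2_arc_def field_simps)
  then have "AE s in ?M. simplex2_arc s $ 1 \<noteq> simplex2_arc s $ 2"
    by (subst AE_restrict_space_iff) auto
  moreover have "{l \<in> space borel. l $ 1 \<noteq> l $ 2} \<in> sets (borel :: (real ^ 2) measure)"
    by measurable
  ultimately have "AE l in distr ?M borel simplex2_arc. l $ 1 \<noteq> l $ 2"
    using AE_distr_iff [OF meas] by simp
  then show ?thesis
    unfolding surface2_def by (rule AE_completion)
qed

text \<open>The factor \<open>\<bar>l\<^sub>1 - l\<^sub>2\<bar>\<close> in the integrand is positive almost everywhere, so no part of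
  \<open>\<rho>\<close> is hidden from the pair of unit vectors.\<close>

lemma R2_improvement_unit_vectors_eq_0_iff:
  fixes \<rho> :: "real ^ 2 \<Rightarrow> real"
  assumes "set_borel_measurable surface2 weight_simplex \<rho>"
    and nonneg: "\<forall>l\<in>weight_simplex. 0 \<le> \<rho> l"
  shows "R2_improvement surface2 \<rho> (vector [0, 0]) (vector [1, 1])
           {vector [1, 0], vector [0, 1]} = 0 \<longleftrightarrow>
         (AE l in surface2. l \<in> weight_simplex \<longrightarrow> \<rho> l = 0)"
proof -
  let ?f = "\<lambda>l. \<bar>l $ 1 - l $ 2\<bar> * (indicator weight_simplex l *\<^sub>R \<rho> l)"
  have "(\<lambda>l :: real ^ 2. \<bar>l $ 1 - l $ 2\<bar>) \<in> borel_measurable surface2"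
    unfolding surface2_def by (intro measurable_completion) simp
  then have meas: "?f \<in> borel_measurable surface2"
    using assms(1) unfolding set_borel_measurable_def by (rule borel_measurable_times)
  have "R2_improvement surface2 \<rho> (vector [0, 0]) (vector [1, 1])
          {vector [1, 0], vector [0, 1]} = (\<integral>\<^sup>+l. ennreal (?f l) \<partial>surface2)"
    unfolding R2_improvement_def
    by (intro nn_integral_cong) (auto simp: improvement_integrand_unit_vectors indicator_def)
  also have "\<dots> = 0 \<longleftrightarrow> (AE l in surface2. ennreal (?f l) = 0)"
    by (intro nn_integral_0_iff_AE measurable_compose [OF meas] measurable_ennreal)
  also have "\<dots> \<longleftrightarrow> (AE l in surface2. l \<in> weight_simplex \<longrightarrow> \<rho> l = 0)"
  proof -
    have "AE l in surface2. ennreal (?f l) = 0 \<longleftrightarrow> (l \<in> weight_simplex \<longrightarrow> \<rho> l = 0)"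
      using AE_surface2_components_distinct
    proof eventually_elim
      case (elim l)
      then show ?case
        using nonneg by (cases "l \<in> weight_simplex") (auto simp: ennreal_eq_0_iff mult_le_0_iff)
    qed
    then show ?thesis
      by (rule eventually_subst)
  qed
  finally show ?thesis .
qed

theorem theorem5p3:
  fixes \<rho> :: "real ^ 2 \<Rightarrow> real"
  assumes "set_borel_measurable surface2 weight_simplex \<rho>"
    and "\<forall>l\<in>weight_simplex. 0 \<le> \<rho> l"
    and "\<not> (AE l in surface2. l \<in> weight_simplex \<longrightarrow> \<rho> l = 0)"
  shows "\<not> (\<exists>K :: real ^ 2 \<Rightarrow> real. integrable lebesgue K \<and>
    (\<forall>A. finite A \<and> A \<noteq> {} \<longrightarrow>
      ereal (weighted_hypervolume K (vector [1, 1]) A) =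
      enn2ereal (R2_improvement surface2 \<rho> (vector [0, 0]) (vector [1, 1]) A)))"
proof
  let ?R2 = "R2_improvement surface2 \<rho> (vector [0, 0]) (vector [1, 1])"
  assume "\<exists>K :: real ^ 2 \<Rightarrow> real. integrable lebesgue K \<and>
    (\<forall>A. finite A \<and> A \<noteq> {} \<longrightarrow>
      ereal (weighted_hypervolume K (vector [1, 1]) A) = enn2ereal (?R2 A))"
  then obtain K :: "real ^ 2 \<Rightarrow> real"
    where K: "\<And>A. finite A \<Longrightarrow> A \<noteq> {} \<Longrightarrow>
      ereal (weighted_hypervolume K (vector [1, 1]) A) = enn2ereal (?R2 A)"
    by auto
  define A :: "(real ^ 2) set" where "A = {vector [1, 0], vector [0, 1]}"
  have "weighted_hypervolume K (vector [1, 1]) A = 0"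
  proof (rule weighted_hypervolume_degenerate)
    show "\<exists>i. a $ i = vector [1, 1] $ i" if "a \<in> A" for a
      using that unfolding A_def by (auto intro: exI [of _ 1] exI [of _ 2])
  qed (simp add: A_def)
  moreover have "ereal (weighted_hypervolume K (vector [1, 1]) A) = enn2ereal (?R2 A)"
    by (rule K) (auto simp: A_def)
  ultimately have "enn2ereal (?R2 A) = enn2ereal 0"
    by (simp add: zero_ennreal.rep_eq zero_ereal_def)
  then have "?R2 A = 0"
    by (simp only: enn2ereal_inject)
  then have "AE l in surface2. l \<in> weight_simplex \<longrightarrow> \<rho> l = 0"
    unfolding A_def R2_improvement_unit_vectors_eq_0_iff [OF assms(1,2)] .
  with assms(3) show False
    by contradiction
qed

end
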